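(* Let $d \ge 1$ and let $C_1, C_2 \subset \mathbb{R}^d$ be compact sets satisfying $\tau(C_1)\tau(C_2) > 1$, where $\tau$ denotes thickness. Then for any $x \in C_1 \times C_2$, the pinned distance set $\Delta_x(C_1 \times C_2)$ has non-empty interior in $\mathbb{R}$.
   Context: Pinned distance set: for $B \subset \mathbb{R}^{m}$ and a point $x \in \mathbb{R}^m$, $\Delta_x(B) := \{|x-y| : y \in B\}$, with $|\cdot|$ the Euclidean norm. Gaps: for a compact set $C \subset \mathbb{R}^d$, let $\{G_n\}_{n\ge 1}$ be the (at most countably many) bounded open path-connected components of the complement of $C$ (the bounded gaps), ordered by non-increasing diameter, and let $E$ be the unbounded open path-connected component of the complement of $C$ (the unbounded gap; when $d=1$, $E$ is the union of the two unbounded intervals). Thickness: if $C$ has at least one bounded gap, $$\tau(C) := \inf_{n} \frac{\operatorname{dist}\left(G_n, \bigcup_{1 \le i \le n-1} G_i \cup E\right)}{\operatorname{diam}(G_n)}.$$ If $C$ has no bounded gap, then $\tau(C) = +\infty$ if $C$ has non-empty interior and $\tau(C) = 0$ if $C$ has empty interior. Here $\operatorname{dist}$ is the usual (infimum) distance between non-empty subsets. Convention: $0 \cdot \infty = 0$. *)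

theory Defs
  imports "HOL-Analysis.Analysis"
begin

definition pinned_distance_set :: "'a::euclidean_space \<Rightarrow> 'a set \<Rightarrow> real set" where
  "pinned_distance_set x B = (\<lambda>y. norm (x - y)) ` B"

text \<open>For compact \<open>C\<close> the complement is open, so these path components are open sets.\<close>

definition complement_path_components :: "'a::euclidean_space set \<Rightarrow> 'a set set" where
  "complement_path_components C = path_component_set (- C) ` (- C)"

definition bounded_gaps :: "'a::euclidean_space set \<Rightarrow> 'a set set" where
  "bounded_gaps C = {U \<in> complement_path_components C. bounded U}"

text \<open>The union covers both cases for compact \<open>C\<close>: in dimension at least 2 there is exactly one
  unbounded component, in dimension 1 there are the two unbounded intervals
  (or the whole line if \<open>C\<close> is empty).\<close>

definition unbounded_gap :: "'a::euclidean_space set \<Rightarrow> 'a set" where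
  "unbounded_gap C = \<Union>{U \<in> complement_path_components C. \<not> bounded U}"

text \<open>Indices start at 0; all of \<open>nat\<close> is used when there are infinitely many bounded gaps.\<close>

definition gap_indices :: "'a::euclidean_space set \<Rightarrow> nat set" where
  "gap_indices C = {n. finite (bounded_gaps C) \<longrightarrow> n < card (bounded_gaps C)}"

definition gap_enumeration :: "'a::euclidean_space set \<Rightarrow> (nat \<Rightarrow> 'a set) \<Rightarrow> bool" where
  "gap_enumeration C G \<longleftrightarrow>
     bij_betw G (gap_indices C) (bounded_gaps C) \<and>
     (\<forall>i\<in>gap_indices C. \<forall>j\<in>gap_indices C. i \<le> j \<longrightarrow> diameter (G j) \<le> diameter (G i))"

definition thickness_along :: "'a::euclidean_space set \<Rightarrow> (nat \<Rightarrow> 'a set) \<Rightarrow> ereal" where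
  "thickness_along C G =
     (INF n\<in>gap_indices C.
        ereal (setdist (G n) ((\<Union>i<n. G i) \<union> unbounded_gap C) / diameter (G n)))"

text \<open>
  The choice of the enumeration (that is, of the order among gaps of equal diameter) is immaterial:
  see \<open>thickness_eq_thickness_along\<close> below.

  In dimension at least 2 the gaps of a compact set need not admit an enumeration by
  non-increasing diameter. There are then infinitely many gaps of diameter at least some
  \<open>\<epsilon> > 0\<close> inside a bounded region, so pairs of them are arbitrarily close to each other, and the
  infimum of \<open>dist(U, V) / diam U\<close> over distinct gaps \<open>U\<close>, \<open>V\<close> with
  \<open>diam U \<le> diam V\<close> is 0. The value 0 is assigned accordingly.
\<close>

definition thickness :: "'a::euclidean_space set \<Rightarrow> ereal" where
  "thickness C =
     (if bounded_gaps C = {} then (if interior C \<noteq> {} then \<infinity> else 0)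
      else if \<exists>G. gap_enumeration C G then thickness_along C (SOME G. gap_enumeration C G)
      else 0)"

lemma thickness_along_le:
  assumes "gap_enumeration C G" "gap_enumeration C H"
  shows "thickness_along C G \<le> thickness_along C H"
  unfolding thickness_along_def[of C H]
proof (rule INF_greatest)
  fix m assume m: "m \<in> gap_indices C"
  let ?S = "(\<Union>j<m. H j) \<union> unbounded_gap C"
  have bG: "bij_betw G (gap_indices C) (bounded_gaps C)"
    and bH: "bij_betw H (gap_indices C) (bounded_gaps C)"
    using assms by (auto simp: gap_enumeration_def)
  have "H m \<in> bounded_gaps C" using bH m by (auto simp: bij_betw_def)
  then obtain n where n: "n \<in> gap_indices C" "G n = H m"
    using bG unfolding bij_betw_def by (metis imageE)
  have low: "thickness_along C G \<le> ereal (dist x y / diameter (G k))"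
    if "k \<in> gap_indices C" "x \<in> G k" "y \<in> (\<Union>i<k. G i) \<union> unbounded_gap C" for k x y
  proof -
    have "thickness_along C G \<le>
        ereal (setdist (G k) ((\<Union>i<k. G i) \<union> unbounded_gap C) / diameter (G k))"
      unfolding thickness_along_def using that(1) by (rule INF_lower)
    also have "\<dots> \<le> ereal (dist x y / diameter (G k))"
    proof -
      have "diameter (G k) \<ge> 0"
        using that(1) bG by (intro diameter_ge_0) (auto simp: bij_betw_def bounded_gaps_def)
      then show ?thesis
        using setdist_le_dist[OF that(2,3)] by (simp add: divide_right_mono)
    qed
    finally show ?thesis .
  qed
  have pt: "thickness_along C G \<le> ereal (dist x y / diameter (H m))"
    if xy: "x \<in> H m" "y \<in> ?S" for x y
  proof (cases "y \<in> unbounded_gap C")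
    case True
    then show ?thesis using low[of n x y] n xy by auto
  next
    case False
    then obtain j where j: "j < m" "y \<in> H j" using xy(2) by auto
    then have jI: "j \<in> gap_indices C" using m by (auto simp: gap_indices_def)
    then have "H j \<in> bounded_gaps C" using bH by (auto simp: bij_betw_def)
    then obtain k where k: "k \<in> gap_indices C" "G k = H j"
      using bG unfolding bij_betw_def by (metis imageE)
    have "H j \<noteq> H m" using bH jI m j(1) by (auto simp: bij_betw_def inj_on_def)
    then have "k \<noteq> n" using k n by auto
    then consider "k < n" | "n < k" by linarith
    then show ?thesis
    proof cases
      case 1
      then show ?thesis using low[of n x y] n k j xy by auto
    next
      case 2
      have "diameter (H m) \<le> diameter (H j)"
        using assms(2) j(1) jI m unfolding gap_enumeration_def by (meson less_imp_le)
      moreover have "diameter (G k) \<le> diameter (G n)"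
        using assms(1) 2 k(1) n(1) unfolding gap_enumeration_def by (meson less_imp_le)
      ultimately have "diameter (G k) = diameter (H m)" using k n by simp
      then show ?thesis using low[of k y x] 2 k n j xy by (auto simp: dist_commute)
    qed
  qed
  have pos: "0 \<le> diameter (H m)"
    using m bH by (intro diameter_ge_0) (auto simp: bij_betw_def bounded_gaps_def)
  show "thickness_along C G \<le> ereal (setdist (H m) ?S / diameter (H m))"
  proof (cases "H m = {} \<or> ?S = {} \<or> diameter (H m) = 0")
    case True
    then have "setdist (H m) ?S / diameter (H m) = 0" by auto
    moreover have "thickness_along C G \<le> 0"
    proof (cases "diameter (H m) = 0 \<or> H m = {}")
      case True
      then have "ereal (setdist (G n) ((\<Union>i<n. G i) \<union> unbounded_gap C) / diameter (G n)) = 0"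
        using n by (auto simp: zero_ereal_def)
      then show ?thesis unfolding thickness_along_def using n(1) by (metis (no_types, lifting) INF_lower)
    next
      case False
      then have S: "?S = {}" using True by blast
      have "0 \<in> gap_indices C" using m by (auto simp: gap_indices_def)
      moreover have "unbounded_gap C = {}" using S by blast
      then have "ereal (setdist (G 0) ((\<Union>i<0. G i) \<union> unbounded_gap C) / diameter (G 0)) = 0"
        by (simp add: zero_ereal_def)
      ultimately show ?thesis unfolding thickness_along_def by (metis (no_types, lifting) INF_lower)
    qed
    ultimately show ?thesis by (simp only: zero_ereal_def)
  next
    case False
    then have ne: "H m \<noteq> {}" "?S \<noteq> {}" and d: "diameter (H m) > 0" using pos by auto
    show ?thesis
    proof (cases "thickness_along C G")
      case (real r)
      have "r * diameter (H m) \<le> dist x y" if "x \<in> H m" "y \<in> ?S" for x y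
        using pt[OF that] d real by (simp add: pos_le_divide_eq)
      then have "r * diameter (H m) \<le> setdist (H m) ?S"
        using le_setdistI[OF ne] by blast
      then show ?thesis using real d by (simp add: pos_le_divide_eq)
    next
      case PInf
      then show ?thesis using pt ne by (metis all_not_in_conv ereal_infty_less_eq(1) PInfty_neq_ereal(1))
    next
      case MInf
      then show ?thesis by simp
    qed
  qed
qed

lemma thickness_eq_thickness_along:
  assumes "bounded_gaps C \<noteq> {}" "gap_enumeration C G"
  shows "thickness C = thickness_along C G"
proof -
  have "gap_enumeration C (SOME G. gap_enumeration C G)" 
    using assms(2) by (rule someI[of "gap_enumeration C"])
  then have "thickness_along C (SOME G. gap_enumeration C G) = thickness_along C G"
    using thickness_along_le assms(2) by (blast intro: antisym)
  then show ?thesis using assms by (auto simp: thickness_def)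
qed

end

theory Submission
  imports Defs
begin

text \<open>
  Because \<open>x\<close> lies in \<open>C1 \<times> C2\<close>, freezing one coordinate at \<open>x\<close> shows that the pinned distance set
  contains the pinned distance sets of both factors. So nothing is left to do when a factor has
  interior points. Otherwise both factors have bounded gaps, both thicknesses are positive reals,
  and what the thickness provides is that two distinct gaps, one of them bounded, are at distance
  at least the thickness times the smaller diameter (\<open>gaps_separated\<close>). The argument then depends on
  the dimension.

  In dimension at least 2 positive thickness of one factor suffices
  (\<open>pinned_distance_set_thick_interior\<close>). If the distances to \<open>C1\<close> had empty interior, spheres about the
  pin that miss \<open>C1\<close> would have a dense set of radii. Spheres are connected, so each lies in a
  single gap. Some bounded gap contains such a sphere, and the supremum of the radii occurring in
  that gap is a place where spheres in two different gaps, both of diameter bounded below, come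
  arbitrarily close.

  In dimension 1 the squared distances form a sumset of two sets of squares, and the Newhouse gap
  lemma (\<open>line_gap_lemma\<close>) applied to one summand and a reflection of the other shows that a sumset of two
  thick sets contains an interval (\<open>thick_sums_contain_interval\<close>). The square map is not affine, but on a
  short interval away from 0 it distorts lengths by factors whose ratio is close to 1. Next to a gap
  there are arbitrarily short pieces that are as thick as the whole set (\<open>thick_piece_near_gap\<close>), and as
  the product of the thicknesses exceeds 1 strictly, it still does so after a small enough distortion
  (\<open>thick_sum_of_squares\<close>). The two pieces may have very different lengths: the
  gap lemma asks only that the convex hulls overlap properly.
\<close>

section \<open>Separation of gaps\<close>

text \<open>An infinite thickness occurs only without bounded gaps, as every quotient in the infimum is real.\<close>

lemma thickness_real:
  fixes C :: "'a::euclidean_space set"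
  assumes "bounded_gaps C \<noteq> {}"
  shows "\<exists>\<tau>\<ge>0. thickness C = ereal \<tau>"
proof (cases "\<exists>G. gap_enumeration C G")
  case True
  then obtain G where G: "gap_enumeration C G" by blast
  then have eq: "thickness C = thickness_along C G"
    using assms thickness_eq_thickness_along by blast
  have bij: "bij_betw G (gap_indices C) (bounded_gaps C)"
    using G by (simp add: gap_enumeration_def)
  have "gap_indices C \<noteq> {}"
    using assms bij by (auto simp: bij_betw_def)
  then obtain n where n: "n \<in> gap_indices C" by blast
  have "0 \<le> diameter (G k)" if "k \<in> gap_indices C" for k
    using that bij by (intro diameter_ge_0) (auto simp: bij_betw_def bounded_gaps_def)
  then have "0 \<le> thickness_along C G"
    unfolding thickness_along_def
    by (intro INF_greatest) (simp add: setdist_pos_le)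
  moreover have "thickness_along C G
      \<le> ereal (setdist (G n) ((\<Union>i<n. G i) \<union> unbounded_gap C) / diameter (G n))"
    unfolding thickness_along_def using n by (rule INF_lower)
  ultimately show ?thesis
    unfolding eq by (cases "thickness_along C G") auto
next
  case False
  then have "thickness C = ereal 0"
    using assms unfolding thickness_def zero_ereal_def by presburger
  then show ?thesis by blast
qed

text \<open>
  The working form of thickness, free of enumerations: of two bounded gaps, the later
  one is no larger, and its quotient accounts for their distance. Stating the conclusion as
  a disjunction avoids deciding which gap comes later.
\<close>

lemma gaps_separated:
  fixes C :: "'a::euclidean_space set"
  assumes \<tau>: "0 < \<tau>" "ereal \<tau> \<le> thickness C"
    and U: "U \<in> bounded_gaps C" and V: "V \<in> complement_path_components C" "V \<noteq> U"
    and uv: "u \<in> U" "v \<in> V"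
  shows "\<tau> * diameter U \<le> dist u v \<or> bounded V \<and> \<tau> * diameter V \<le> dist u v"
proof -
  have ne: "bounded_gaps C \<noteq> {}" using U by blast
  have "\<exists>G. gap_enumeration C G"
  proof (rule ccontr)
    assume "\<nexists>G. gap_enumeration C G"
    then have "thickness C = 0" using ne unfolding thickness_def by presburger
    then show False using \<tau> by (simp add: zero_ereal_def)
  qed
  then obtain G where G: "gap_enumeration C G" by blast
  then have eq: "thickness C = thickness_along C G"
    using ne thickness_eq_thickness_along by blast
  have bij: "bij_betw G (gap_indices C) (bounded_gaps C)"
    using G by (simp add: gap_enumeration_def)
  have low: "\<tau> * diameter (G n) \<le> dist x y"
    if n: "n \<in> gap_indices C" and x: "x \<in> G n" and y: "y \<in> (\<Union>i<n. G i) \<union> unbounded_gap C" for n x y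
  proof (cases "diameter (G n) = 0")
    case True
    then show ?thesis by simp
  next
    case False
    have "0 \<le> diameter (G n)"
      using n bij by (intro diameter_ge_0) (auto simp: bij_betw_def bounded_gaps_def)
    then have pos: "0 < diameter (G n)" using False by simp
    have "thickness_along C G
      \<le> ereal (setdist (G n) ((\<Union>i<n. G i) \<union> unbounded_gap C) / diameter (G n))"
      unfolding thickness_along_def using n by (rule INF_lower)
    then have "\<tau> \<le> setdist (G n) ((\<Union>i<n. G i) \<union> unbounded_gap C) / diameter (G n)"
      using \<tau>(2) eq by (metis ereal_less_eq(3) order_trans)
    then have "\<tau> * diameter (G n) \<le> setdist (G n) ((\<Union>i<n. G i) \<union> unbounded_gap C)"
      using pos by (simp add: pos_le_divide_eq)
    also have "\<dots> \<le> dist x y" using setdist_le_dist[OF x y] .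
    finally show ?thesis .
  qed
  obtain n where n: "n \<in> gap_indices C" "U = G n"
    using U bij unfolding bij_betw_def by (metis imageE)
  show ?thesis
  proof (cases "bounded V")
    case False
    then have "v \<in> unbounded_gap C"
      using V uv by (auto simp: unbounded_gap_def)
    then show ?thesis using low n uv by blast
  next
    case True
    then have "V \<in> bounded_gaps C" using V by (simp add: bounded_gaps_def)
    then obtain m where m: "m \<in> gap_indices C" "V = G m"
      using bij unfolding bij_betw_def by (metis imageE)
    consider "m < n" | "n < m" using m n V by (metis linorder_neqE_nat)
    then show ?thesis
    proof cases
      case 1
      then show ?thesis using low[of n u v] n m uv by auto
    next
      case 2
      then show ?thesis using low[of m v u] True n m uv by (auto simp: dist_commute)
    qed
  qed
qed

lemma bounded_gaps_nonempty_if_thickness_nonzero: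
  fixes C :: "'a::euclidean_space set"
  assumes "thickness C \<noteq> 0" "interior C = {}"
  shows "bounded_gaps C \<noteq> {}"
  using assms by (auto simp: thickness_def)

lemma gap_eqI:
  assumes "V \<in> complement_path_components C" "z \<in> V"
  shows "V = path_component_set (- C) z"
proof -
  obtain w where "V = path_component_set (- C) w"
    using assms(1) by (auto simp: complement_path_components_def)
  then show ?thesis using assms(2) by (metis path_component_eq)
qed

lemma path_connected_subset_gap:
  assumes "path_connected S" "S \<subseteq> - C" "z \<in> S" "V \<in> complement_path_components C" "z \<in> V"
  shows "S \<subseteq> V"
  using assms gap_eqI path_component_maximal by metis

section \<open>Pinned distances to a single set\<close>

lemma pinned_distance_set_fst_subset:
  fixes x :: "'a::euclidean_space \<times> 'a"
  assumes "snd x \<in> C2"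
  shows "pinned_distance_set (fst x) C1 \<subseteq> pinned_distance_set x (C1 \<times> C2)"
proof
  fix t assume "t \<in> pinned_distance_set (fst x) C1"
  then obtain y where "y \<in> C1" "t = norm (fst x - y)" by (auto simp: pinned_distance_set_def)
  then have "(y, snd x) \<in> C1 \<times> C2" "t = norm (x - (y, snd x))"
    using assms by (auto simp: norm_prod_def)
  then show "t \<in> pinned_distance_set x (C1 \<times> C2)"
    unfolding pinned_distance_set_def by blast
qed

lemma pinned_distance_set_snd_subset:
  fixes x :: "'a::euclidean_space \<times> 'a"
  assumes "fst x \<in> C1"
  shows "pinned_distance_set (snd x) C2 \<subseteq> pinned_distance_set x (C1 \<times> C2)"
proof
  fix t assume "t \<in> pinned_distance_set (snd x) C2"
  then obtain y where "y \<in> C2" "t = norm (snd x - y)" by (auto simp: pinned_distance_set_def)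
  then have "(fst x, y) \<in> C1 \<times> C2" "t = norm (x - (fst x, y))"
    using assms by (auto simp: norm_prod_def)
  then show "t \<in> pinned_distance_set x (C1 \<times> C2)"
    unfolding pinned_distance_set_def by blast
qed

text \<open>
  A short segment issuing from an interior point radially away from the pin lies in the set, and the
  distance to the pin grows at unit speed along it.
\<close>

lemma pinned_distance_set_interior:
  fixes C :: "'a::euclidean_space set"
  assumes "interior C \<noteq> {}"
  shows "interior (pinned_distance_set x C) \<noteq> {}"
proof -
  obtain y r where r: "r > 0" "cball y r \<subseteq> C"
    using assms by (metis all_not_in_conv mem_interior_cball)
  \<comment> \<open>If \<open>y\<close> is the pin itself, every direction is radial.\<close>
  obtain e :: 'a where e: "norm e = 1" "y - x = norm (y - x) *\<^sub>R e"
  proof (cases "y = x")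
    case True
    then show ?thesis using that[of "SOME b. b \<in> Basis"] by (simp add: some_in_eq)
  next
    case False
    then show ?thesis using that[of "sgn (y - x)"] by (simp add: norm_sgn sgn_div_norm)
  qed
  have "{norm (y - x)<..<norm (y - x) + r} \<subseteq> pinned_distance_set x C"
  proof
    fix t assume t: "t \<in> {norm (y - x)<..<norm (y - x) + r}"
    let ?z = "x + t *\<^sub>R e"
    have "?z - y = (t - norm (y - x)) *\<^sub>R e"
      using e(2) by (simp add: algebra_simps)
    then have "dist ?z y = t - norm (y - x)"
      using t e(1) unfolding dist_norm by simp
    then have "?z \<in> cball y r" using t by (simp add: dist_commute)
    then have "?z \<in> C" using r by blast
    moreover have "t > 0" using t by (smt (verit) greaterThanLessThan_iff norm_ge_zero)
    then have "norm (x - ?z) = t" using e(1) by simp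
    ultimately show "t \<in> pinned_distance_set x C"
      unfolding pinned_distance_set_def by (metis imageI)
  qed
  then have "{norm (y - x)<..<norm (y - x) + r} \<subseteq> interior (pinned_distance_set x C)"
    by (simp add: interior_maximal)
  moreover have "norm (y - x) + r/2 \<in> {norm (y - x)<..<norm (y - x) + r}" using r by auto
  ultimately show ?thesis by blast
qed

text \<open>
  Spheres are connected, unlike in dimension 1, so every sphere that misses \<open>C\<close> lies inside one gap. For a bounded gap \<open>G\<close> that contains a sphere of radius \<open>t0\<close>, let \<open>m\<close> be the supremum of the
  radii of spheres in \<open>G\<close>. Just above \<open>m\<close> there are spheres in gaps other than \<open>G\<close>, by density of the
  radii that avoid \<open>C\<close>; all these gaps have diameter at least \<open>t0\<close>, so they cannot approach \<open>G\<close>.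
\<close>

lemma pinned_distance_set_thick_interior:
  fixes C :: "'a::euclidean_space set"
  assumes dim: "2 \<le> DIM('a)" and th: "0 < \<tau>" "ereal \<tau> \<le> thickness C"
    and ne: "bounded_gaps C \<noteq> {}" and cl: "closed C"
  shows "interior (pinned_distance_set x C) \<noteq> {}"
proof
  assume emp: "interior (pinned_distance_set x C) = {}"
  define D where "D = pinned_distance_set x C"
  have dense: "\<exists>t. l < t \<and> t < h \<and> t \<notin> D" if "l < h" for l h
  proof (rule ccontr)
    assume "\<not> ?thesis"
    then have "{l<..<h} \<subseteq> D" by auto
    then have "{l<..<h} \<subseteq> interior D" by (simp add: interior_maximal)
    then show False using emp that by (auto simp: D_def dest: greaterThanLessThan_empty_iff[THEN iffD1])
  qed
  have out: "sphere x t \<subseteq> - C" if "t \<notin> D" for t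
    using that by (auto simp: D_def pinned_distance_set_def dist_norm)
  have sub: "sphere x t \<subseteq> V" if "t \<notin> D" "V \<in> complement_path_components C" "z \<in> V" "dist x z = t" for t V z
    using path_connected_subset_gap[of "sphere x t" C z V] path_connected_sphere[OF dim] that out by auto
  obtain G where G: "G \<in> bounded_gaps C" using ne by blast
  then have Gc: "G \<in> complement_path_components C" and Gb: "bounded G"
    by (auto simp: bounded_gaps_def)
  have Go: "open G"
    using Gc cl by (auto simp: complement_path_components_def open_path_component open_Compl)
  obtain w where "w \<in> G"
    using Gc by (auto simp: complement_path_components_def intro: path_component_refl)
  \<comment> \<open>The distances to the open set \<open>G\<close> fill an interval, so a radius avoiding \<open>C\<close> occurs among them.\<close>
  obtain t0 where t0: "t0 > 0" "t0 \<notin> D" "sphere x t0 \<subseteq> G"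
  proof -
    have "interior G \<noteq> {}" using Go \<open>w \<in> G\<close> by (auto simp: interior_open)
    then have "interior (pinned_distance_set x G) \<noteq> {}" by (rule pinned_distance_set_interior)
    then obtain s r where r: "r > 0" "ball s r \<subseteq> pinned_distance_set x G"
      by (metis all_not_in_conv mem_interior)
    obtain t where t: "s < t" "t < s + r" "t \<notin> D" using dense[of s "s + r"] r by auto
    have s: "s \<in> pinned_distance_set x G" using r by auto
    then have "0 \<le> s" by (auto simp: pinned_distance_set_def)
    have "t \<in> pinned_distance_set x G" using r t by (auto simp: subset_iff dist_real_def)
    then obtain z where "z \<in> G" "t = dist x z" by (auto simp: pinned_distance_set_def dist_norm)
    then have "sphere x t \<subseteq> G" using sub[OF t(3) Gc] by metis
    then show ?thesis using that[of t] t \<open>0 \<le> s\<close> by simp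
  qed
  obtain e :: 'a where "e \<in> Basis" using nonempty_Basis by blast
  then have e: "norm e = 1" by simp
  define ray where "ray t = x + t *\<^sub>R e" for t
  have ray: "ray t \<in> sphere x t" if "t > 0" for t
    using that e by (simp add: ray_def dist_norm)
  have ray_dist: "dist (ray s) (ray t) = \<bar>s - t\<bar>" for s t
  proof -
    have "ray s - ray t = (s - t) *\<^sub>R e" by (simp add: ray_def algebra_simps)
    then show ?thesis using e by (simp add: dist_norm)
  qed
  have diam: "t0 \<le> diameter V" if "bounded V" "sphere x t \<subseteq> V" "t0 \<le> t" for V t
  proof -
    have "ray t \<in> V" "x - t *\<^sub>R e \<in> V"
      using that t0(1) ray[of t] e by (auto simp: subset_iff dist_norm)
    then have "dist (ray t) (x - t *\<^sub>R e) \<le> diameter V"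
      using that(1) diameter_bounded_bound by blast
    moreover have "dist (ray t) (x - t *\<^sub>R e) = 2 * t"
    proof -
      have "ray t - (x - t *\<^sub>R e) = (2 * t) *\<^sub>R e" by (simp add: ray_def flip: scaleR_add_left)
      then show ?thesis using e that t0 by (simp add: dist_norm)
    qed
    ultimately show ?thesis using that t0(1) by linarith
  qed
  define W where "W = {t. t \<ge> t0 \<and> t \<notin> D \<and> sphere x t \<subseteq> G}"
  have "t0 \<in> W" using t0 by (simp add: W_def)
  have "bdd_above W"
  proof -
    obtain R where R: "\<And>y. y \<in> G \<Longrightarrow> dist x y \<le> R"
      using Gb bounded_any_center by blast
    have "t \<le> R" if "t \<in> W" for t
      using that R[of "ray t"] ray[of t] t0(1) by (auto simp: W_def subset_iff)
    then show ?thesis by (auto simp: bdd_above_def)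
  qed
  define \<epsilon> where "\<epsilon> = \<tau> * t0 / 2"
  have "\<epsilon> > 0" using th t0 by (simp add: \<epsilon>_def)
  obtain t where t: "t \<in> W" "Sup W - \<epsilon> < t"
    using less_cSupD[of W "Sup W - \<epsilon>"] \<open>t0 \<in> W\<close> \<open>\<epsilon> > 0\<close> by auto
  have "t \<le> Sup W" "t0 \<le> t" using t \<open>bdd_above W\<close> by (auto intro: cSup_upper simp: W_def)
  obtain t' where t': "Sup W < t'" "t' < Sup W + \<epsilon>" "t' \<notin> D"
    using dense[of "Sup W" "Sup W + \<epsilon>"] \<open>\<epsilon> > 0\<close> by auto
  have gt: "t0 \<le> t'" "t < t'" using t' \<open>t \<le> Sup W\<close> \<open>t0 \<le> t\<close> by auto
  define V where "V = path_component_set (- C) (ray t')"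
  have "ray t' \<in> - C" using out[OF t'(3)] ray[of t'] gt t0(1) by auto
  then have V: "V \<in> complement_path_components C" "ray t' \<in> V"
    by (auto simp: V_def complement_path_components_def path_component_refl_eq)
  have SV: "sphere x t' \<subseteq> V"
    using sub[OF t'(3) V] ray[of t'] gt t0(1) by auto
  have "V \<noteq> G"
  proof
    assume "V = G"
    then have "t' \<in> W" using SV gt t'(3) by (simp add: W_def)
    then show False using t'(1) \<open>bdd_above W\<close> cSup_upper by fastforce
  qed
  have "ray t \<in> G" using t ray[of t] t0(1) by (auto simp: W_def)
  then have "\<tau> * diameter G \<le> dist (ray t) (ray t') \<or> bounded V \<and> \<tau> * diameter V \<le> dist (ray t) (ray t')"
    using gaps_separated[OF th G V(1) \<open>V \<noteq> G\<close>] V(2) by blast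
  moreover have "\<tau> * t0 \<le> \<tau> * diameter G"
    using diam[OF Gb t0(3)] th by simp
  moreover have "\<tau> * t0 \<le> \<tau> * diameter V" if "bounded V"
    using diam[OF that SV gt(1)] th by simp
  ultimately have "\<tau> * t0 \<le> dist (ray t) (ray t')" by linarith
  moreover have "dist (ray t) (ray t') < 2 * \<epsilon>"
    using t t' gt by (simp add: ray_dist)
  ultimately show False by (simp add: \<epsilon>_def)
qed

section \<open>A gap lemma on the real line\<close>

definition line_gap :: "real set \<Rightarrow> real \<Rightarrow> real \<Rightarrow> bool" where
  "line_gap A p q \<longleftrightarrow> p \<in> A \<and> q \<in> A \<and> p < q \<and> (\<forall>z\<in>A. z \<le> p \<or> q \<le> z)"

text \<open>
  The hull of \<open>A\<close> has to extend beyond each gap by \<open>\<tau>\<close> times its length, and two gaps are separated by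
  \<open>\<tau>\<close> times the length of the shorter one. The symmetric minimum makes the notion robust: a map with
  small distortion may reverse the order of two gaps of nearly equal length, yet it changes this
  inequality only by the ratio of its Lipschitz constants.
\<close>

definition line_thick :: "real \<Rightarrow> real set \<Rightarrow> bool" where
  "line_thick \<tau> A \<longleftrightarrow>
     (\<forall>p q. line_gap A p q \<longrightarrow> (\<exists>z\<in>A. z \<le> p - \<tau> * (q - p)) \<and> (\<exists>z\<in>A. q + \<tau> * (q - p) \<le> z)) \<and>
     (\<forall>p q c d. line_gap A p q \<longrightarrow> line_gap A c d \<longrightarrow> q \<le> c \<longrightarrow> \<tau> * min (q - p) (d - c) \<le> c - q)"

lemma line_thickI:
  assumes "\<And>p q. line_gap A p q \<Longrightarrow> \<exists>z\<in>A. z \<le> p - \<tau> * (q - p)"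
    and "\<And>p q. line_gap A p q \<Longrightarrow> \<exists>z\<in>A. q + \<tau> * (q - p) \<le> z"
    and "\<And>p q c d. line_gap A p q \<Longrightarrow> line_gap A c d \<Longrightarrow> q \<le> c \<Longrightarrow> \<tau> * min (q - p) (d - c) \<le> c - q"
  shows "line_thick \<tau> A"
  using assms unfolding line_thick_def by blast

lemma line_thickD:
  assumes "line_thick \<tau> A" "line_gap A p q"
  shows "\<exists>z\<in>A. z \<le> p - \<tau> * (q - p)" "\<exists>z\<in>A. q + \<tau> * (q - p) \<le> z"
    "line_gap A c d \<Longrightarrow> q \<le> c \<Longrightarrow> \<tau> * min (q - p) (d - c) \<le> c - q"
  using assms unfolding line_thick_def by blast+

lemma line_gap_around:
  assumes "compact A" "l \<in> A" "r \<in> A" "l \<le> x" "x \<le> r" "x \<notin> A"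
  shows "\<exists>p q. line_gap A p q \<and> l \<le> p \<and> p < x \<and> x < q \<and> q \<le> r"
proof -
  have "compact (A \<inter> {l..x})" "compact (A \<inter> {x..r})"
    using assms(1) by (auto intro: compact_Int_closed)
  moreover have "A \<inter> {l..x} \<noteq> {}" "A \<inter> {x..r} \<noteq> {}"
    using assms by auto
  ultimately obtain p q where p: "p \<in> A \<inter> {l..x}" "\<forall>z\<in>A \<inter> {l..x}. z \<le> p"
    and q: "q \<in> A \<inter> {x..r}" "\<forall>z\<in>A \<inter> {x..r}. q \<le> z"
    by (metis compact_attains_sup compact_attains_inf)
  have "z \<le> p \<or> q \<le> z" if "z \<in> A" for z
    using p q that by (cases "l \<le> z"; cases "z \<le> r"; cases "z \<le> x") force+
  moreover have "p \<noteq> x" "q \<noteq> x" using p q assms by auto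
  ultimately show ?thesis
    using p q by (intro exI[of _ p] exI[of _ q]) (auto simp: line_gap_def)
qed

text \<open>
  The descent step. Two intervals are linked when each contains exactly one endpoint of the other.
  As \<open>a * b > 1\<close>, either \<open>a\<close> times the gap of \<open>A\<close> exceeds the gap of \<open>B\<close>, or \<open>b\<close> times the gap
  of \<open>B\<close> exceeds the gap of \<open>A\<close>. In the first case
  the bridge to the right of the gap of \<open>A\<close> reaches beyond \<open>s\<close>. Since \<open>s\<close> belongs to \<open>B\<close>, it lies in
  another gap of \<open>A\<close>, which is so near that it must be shorter, and which is linked with the
  gap of \<open>B\<close> from the other side. In the second case the bridge to the left of the gap of \<open>B\<close> reaches
  beyond \<open>p\<close>, and the gap of \<open>B\<close> around \<open>p\<close> takes this role.
\<close>

lemma linked_gaps_shrink: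
  assumes A: "compact A" "line_thick a A" "0 < a" and B: "compact B" "line_thick b B" "0 < b"
    and ab: "1 < a * b" and disj: "A \<inter> B = {}"
    and gaps: "line_gap A p q" "line_gap B r s" and linked: "p < r" "r < q" "q < s"
  shows "\<exists>p' q' r' s'. line_gap A p' q' \<and> line_gap B r' s' \<and> r' < p' \<and> p' < s' \<and> s' < q' \<and>
    (q' - p') + (s' - r') < (q - p) + (s - r)"
proof -
  \<comment> \<open>If both inequalities failed, multiplying them would give \<open>a * b \<le> 1\<close>.\<close>
  consider "s - r < a * (q - p)" | "q - p < b * (s - r)"
  proof -
    have "\<not> (a * (q - p) \<le> s - r \<and> b * (s - r) \<le> q - p)"
    proof
      assume *: "a * (q - p) \<le> s - r \<and> b * (s - r) \<le> q - p"
      then have "b * (a * (q - p)) \<le> b * (s - r)"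
        using B(3) by (intro mult_left_mono) auto
      then have "(a * b) * (q - p) \<le> 1 * (q - p)"
        using * by (simp add: algebra_simps)
      then show False using ab linked by (simp add: mult_le_cancel_right)
    qed
    then show ?thesis using that by linarith
  qed
  then show ?thesis
  proof cases
    case 1
    obtain z where z: "z \<in> A" "q + a * (q - p) \<le> z"
      using line_thickD(2)[OF A(2) gaps(1)] by blast
    have "q \<in> A" "s \<notin> A" using gaps disj by (auto simp: line_gap_def)
    then obtain p' q' where g: "line_gap A p' q'" "q \<le> p'" "p' < s" "s < q'"
      using line_gap_around[OF A(1), of q z s] z 1 linked by auto
    have "a * min (q - p) (q' - p') \<le> p' - q"
      using line_thickD(3)[OF A(2) gaps(1) g(1,2)] .
    then have "a * min (q - p) (q' - p') < a * (q - p)" using g linked 1 by linarith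
    then have "q' - p' < q - p" using A(3) by (auto simp: min_def split: if_splits)
    then show ?thesis using g gaps(2) linked by (intro exI[of _ p'] exI[of _ q'] exI[of _ r] exI[of _ s]) auto
  next
    case 2
    obtain z where z: "z \<in> B" "z \<le> r - b * (s - r)"
      using line_thickD(1)[OF B(2) gaps(2)] by blast
    have "r \<in> B" "p \<notin> B" using gaps disj by (auto simp: line_gap_def)
    then obtain r' s' where g: "line_gap B r' s'" "s' \<le> r" "r' < p" "p < s'"
      using line_gap_around[OF B(1), of z r p] z 2 linked by auto
    have "b * min (s' - r') (s - r) \<le> r - s'"
      using line_thickD(3)[OF B(2) g(1) gaps(2) g(2)] .
    then have "b * min (s' - r') (s - r) < b * (s - r)" using g linked 2 by linarith
    then have "s' - r' < s - r" using B(3) by (auto simp: min_def split: if_splits)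
    then show ?thesis using g gaps(1) linked by (intro exI[of _ p] exI[of _ q] exI[of _ r'] exI[of _ s']) auto
  qed
qed

text \<open>
  A linked pair of least total length would contradict \<open>linked_gaps_shrink\<close>, and compactness supplies
  one. With weak inequalities throughout, being a linked pair is a closed condition; degenerate limits
  do not occur, because a coincidence of endpoints would be a common point of \<open>A\<close> and \<open>B\<close>.
\<close>

lemma no_linked_gaps:
  assumes A: "compact A" "line_thick a A" "0 < a" and B: "compact B" "line_thick b B" "0 < b"
    and ab: "1 < a * b" and disj: "A \<inter> B = {}"
    and gaps: "line_gap A p q" "line_gap B r s" and linked: "p < r" "r < q" "q < s"
  shows False
proof -
  define K where "K = {(p, q, r, s). p \<in> A \<and> q \<in> A \<and> r \<in> B \<and> s \<in> B \<and>
      (\<forall>z\<in>A. z \<le> p \<or> q \<le> z) \<and> (\<forall>z\<in>B. z \<le> r \<or> s \<le> z) \<and>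
      (p \<le> r \<and> r \<le> q \<and> q \<le> s \<or> r \<le> p \<and> p \<le> s \<and> s \<le> q)}"
  \<comment> \<open>The same conditions in terms of projections, in which closedness is syntactic.\<close>
  have "closed {w :: real \<times> real \<times> real \<times> real.
      (\<forall>z\<in>A. z \<le> fst w \<or> fst (snd w) \<le> z) \<and>
      (\<forall>z\<in>B. z \<le> fst (snd (snd w)) \<or> snd (snd (snd w)) \<le> z) \<and>
      (fst w \<le> fst (snd (snd w)) \<and> fst (snd (snd w)) \<le> fst (snd w) \<and> fst (snd w) \<le> snd (snd (snd w)) \<or>
       fst (snd (snd w)) \<le> fst w \<and> fst w \<le> snd (snd (snd w)) \<and> snd (snd (snd w)) \<le> fst (snd w))}"
    (is "closed ?Z")
    unfolding Ball_def
    by (intro closed_Collect_conj closed_Collect_disj closed_Collect_all closed_Collect_imp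
        closed_Collect_le continuous_intros open_Collect_const)
  then have "compact ((A \<times> A \<times> B \<times> B) \<inter> ?Z)"
    using A(1) B(1) by (intro compact_Int_closed compact_Times)
  also have "(A \<times> A \<times> B \<times> B) \<inter> ?Z = K"
    by (auto simp: K_def)
  finally have "compact K" .
  have in_K: "line_gap A p q \<and> line_gap B r s \<and> (p < r \<and> r < q \<and> q < s \<or> r < p \<and> p < s \<and> s < q)
      \<longleftrightarrow> (p, q, r, s) \<in> K" for p q r s
  proof
    assume "(p, q, r, s) \<in> K"
    moreover from this have "p \<noteq> r" "r \<noteq> q" "q \<noteq> s" "p \<noteq> s"
      using disj by (auto simp: K_def)
    ultimately show "line_gap A p q \<and> line_gap B r s \<and> (p < r \<and> r < q \<and> q < s \<or> r < p \<and> p < s \<and> s < q)"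
      by (auto simp: K_def line_gap_def)
  qed (auto simp: K_def line_gap_def)
  define f :: "real \<times> real \<times> real \<times> real \<Rightarrow> real" where "f = (\<lambda>(p, q, r, s). (q - p) + (s - r))"
  have "continuous_on K f"
    unfolding f_def case_prod_unfold by (intro continuous_intros)
  moreover have "K \<noteq> {}" using gaps linked in_K by blast
  ultimately obtain w where "w \<in> K" and min: "\<And>v. v \<in> K \<Longrightarrow> f w \<le> f v"
    using continuous_attains_inf[OF \<open>compact K\<close>] by blast
  \<comment> \<open>A minimal pair linked from either side shrinks; the second case is the first with \<open>A\<close> and \<open>B\<close> exchanged.\<close>
  obtain p q r s where w: "w = (p, q, r, s)" by (metis prod_cases4)
  have g: "line_gap A p q" "line_gap B r s" using \<open>w \<in> K\<close> w in_K by blast+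
  from \<open>w \<in> K\<close> w in_K consider "p < r" "r < q" "q < s" | "r < p" "p < s" "s < q" by blast
  then obtain v where "v \<in> K" "f v < f w"
  proof cases
    case 1
    obtain p' q' r' s' where n: "line_gap A p' q'" "line_gap B r' s'" "r' < p'" "p' < s'" "s' < q'"
      "(q' - p') + (s' - r') < (q - p) + (s - r)"
      using linked_gaps_shrink[OF A B ab disj g 1] by blast
    then have "(p', q', r', s') \<in> K" using in_K by blast
    then show ?thesis using n(6) by (intro that[of "(p', q', r', s')"]) (auto simp: f_def w)
  next
    case 2
    obtain r' s' p' q' where n: "line_gap B r' s'" "line_gap A p' q'" "p' < r'" "r' < q'" "q' < s'"
      "(s' - r') + (q' - p') < (s - r) + (q - p)"
      using linked_gaps_shrink[OF B A _ _ g(2,1) 2] ab disj by (auto simp: mult.commute Int_commute)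
    then have "(p', q', r', s') \<in> K" using in_K by blast
    then show ?thesis using n(6) by (intro that[of "(p', q', r', s')"]) (auto simp: f_def w)
  qed
  then show False using min by fastforce
qed

text \<open>
  The Newhouse gap lemma: for disjoint sets, the gap of \<open>A\<close> around \<open>\<gamma>\<close> and the gap of \<open>B\<close> around the
  right end of the former are linked.
\<close>

lemma line_gap_lemma:
  assumes A: "compact A" "line_thick a A" "0 < a" and B: "compact B" "line_thick b B" "0 < b"
    and ab: "1 < a * b"
    and pts: "\<alpha> \<in> A" "\<beta> \<in> A" "\<gamma> \<in> B" "\<delta> \<in> B" "\<alpha> < \<gamma>" "\<gamma> < \<beta>" "\<beta> < \<delta>"
  shows "A \<inter> B \<noteq> {}"
proof
  assume disj: "A \<inter> B = {}"
  then have "\<gamma> \<notin> A" using pts by blast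
  then obtain p q where g: "line_gap A p q" "p < \<gamma>" "\<gamma> < q" "q \<le> \<beta>"
    using line_gap_around[OF A(1), of \<alpha> \<beta> \<gamma>] pts by auto
  then have "q \<notin> B" using disj by (auto simp: line_gap_def)
  then obtain r s where "line_gap B r s" "\<gamma> \<le> r" "r < q" "q < s"
    using line_gap_around[OF B(1), of \<gamma> \<delta> q] pts g by auto
  then show False using no_linked_gaps[OF A B ab disj g(1)] g by force
qed

lemma line_gap_reflect:
  "line_gap ((\<lambda>v. s - v) ` B) p q \<longleftrightarrow> line_gap B (s - q) (s - p)"
proof -
  have mem: "v \<in> (\<lambda>v. s - v) ` B \<longleftrightarrow> s - v \<in> B" for v
    by (auto intro: image_eqI[of _ _ "s - v"])
  show ?thesis
    unfolding line_gap_def mem by force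
qed

lemma line_thick_reflect:
  assumes "line_thick \<tau> B"
  shows "line_thick \<tau> ((\<lambda>v. s - v) ` B)"
proof (rule line_thickI)
  fix p q assume "line_gap ((\<lambda>v. s - v) ` B) p q"
  then have g: "line_gap B (s - q) (s - p)" by (simp add: line_gap_reflect)
  show "\<exists>z\<in>(\<lambda>v. s - v) ` B. z \<le> p - \<tau> * (q - p)"
    using line_thickD(2)[OF assms g] by force
  show "\<exists>z\<in>(\<lambda>v. s - v) ` B. q + \<tau> * (q - p) \<le> z"
    using line_thickD(1)[OF assms g] by force
next
  fix p q c d
  assume "line_gap ((\<lambda>v. s - v) ` B) p q" "line_gap ((\<lambda>v. s - v) ` B) c d" "q \<le> c"
  then show "\<tau> * min (q - p) (d - c) \<le> c - q"
    using line_thickD(3)[OF assms, of "s - d" "s - c" "s - q" "s - p"]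
    by (simp add: line_gap_reflect min.commute)
qed

text \<open>
  A number \<open>s\<close> is a sum iff \<open>A\<close> meets the reflection of \<open>B\<close> by \<open>v \<mapsto> s - v\<close>. The bounds on \<open>s\<close> say exactly
  that \<open>\<alpha> < s - \<delta> < \<beta> < s - \<gamma>\<close>, the interleaving required by the gap lemma.
\<close>

lemma thick_sums_contain_interval:
  assumes A: "compact A" "line_thick a A" "0 < a" and B: "compact B" "line_thick b B" "0 < b"
    and ab: "1 < a * b"
    and pts: "\<alpha> \<in> A" "\<beta> \<in> A" "\<alpha> < \<beta>" "\<gamma> \<in> B" "\<delta> \<in> B" "\<gamma> < \<delta>"
  shows "{max (\<alpha> + \<delta>) (\<beta> + \<gamma>)<..<\<beta> + \<delta>} \<subseteq> {u + v |u v. u \<in> A \<and> v \<in> B}"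
proof
  fix s assume s: "s \<in> {max (\<alpha> + \<delta>) (\<beta> + \<gamma>)<..<\<beta> + \<delta>}"
  let ?R = "(\<lambda>v. s - v) ` B"
  have "compact ?R" using B(1) by (intro compact_continuous_image continuous_intros)
  then have "A \<inter> ?R \<noteq> {}"
    using line_gap_lemma[OF A _ line_thick_reflect[OF B(2)] B(3) ab pts(1,2), of s "s - \<delta>" "s - \<gamma>"] pts s
    by auto
  then show "s \<in> {u + v |u v. u \<in> A \<and> v \<in> B}" by force
qed

section \<open>Squaring a small piece of a thick set\<close>

lemma line_thick_image:
  assumes A: "line_thick \<tau> A" "0 < \<tau>" and lm: "0 < l" "0 < m"
    and h: "\<And>x y. x \<in> A \<Longrightarrow> y \<in> A \<Longrightarrow> x \<le> y \<Longrightarrow> l * (y - x) \<le> h y - h x \<and> h y - h x \<le> m * (y - x)"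
  shows "line_thick (l / m * \<tau>) (h ` A)"
proof -
  have mono: "h x < h y \<longleftrightarrow> x < y" if "x \<in> A" "y \<in> A" for x y
  proof (cases "x < y")
    case True
    then have "0 < l * (y - x)" using lm by simp
    then show ?thesis using h[of x y] that True by force
  next
    case False
    then have "0 \<le> l * (x - y)" using lm by simp
    then show ?thesis using h[of y x] that False by force
  qed
  have gap: "\<exists>p\<in>A. \<exists>q\<in>A. P = h p \<and> Q = h q \<and> line_gap A p q" if "line_gap (h ` A) P Q" for P Q
  proof -
    obtain p q where pq: "p \<in> A" "q \<in> A" "P = h p" "Q = h q"
      using \<open>line_gap (h ` A) P Q\<close> by (auto simp: line_gap_def)
    then have "line_gap A p q"
      using \<open>line_gap (h ` A) P Q\<close> mono unfolding line_gap_def by (metis imageI not_less)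
    then show ?thesis using pq by blast
  qed
  have scale: "l / m * \<tau> * (h y - h x) \<le> l * (\<tau> * (y - x))" if "x \<in> A" "y \<in> A" "x \<le> y" for x y
  proof -
    have "l / m * \<tau> * (h y - h x) \<le> l / m * \<tau> * (m * (y - x))"
      using h[OF that] A(2) lm by (intro mult_left_mono) auto
    also have "\<dots> = l * (\<tau> * (y - x))" using lm by simp
    finally show ?thesis .
  qed
  show ?thesis
  proof (rule line_thickI)
    fix P Q assume "line_gap (h ` A) P Q"
    then obtain p q where pq: "p \<in> A" "q \<in> A" "P = h p" "Q = h q" "line_gap A p q"
      using gap by blast
    then have "p < q" by (simp add: line_gap_def)
    note sc = scale[OF pq(1,2) less_imp_le[OF \<open>p < q\<close>]]
    have pos: "0 \<le> \<tau> * (q - p)" using A(2) \<open>p < q\<close> by simp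
    obtain z where z: "z \<in> A" "z \<le> p - \<tau> * (q - p)" using line_thickD(1)[OF A(1) pq(5)] by blast
    have "l * (\<tau> * (q - p)) \<le> l * (p - z)" using z lm by (intro mult_left_mono) auto
    also have "\<dots> \<le> h p - h z" using h[OF z(1) pq(1)] z pos by auto
    finally have "h z \<le> P - l / m * \<tau> * (Q - P)" using sc unfolding pq(3,4) by linarith
    then show "\<exists>z\<in>h ` A. z \<le> P - l / m * \<tau> * (Q - P)" using z by blast
    obtain z where z: "z \<in> A" "q + \<tau> * (q - p) \<le> z" using line_thickD(2)[OF A(1) pq(5)] by blast
    have "l * (\<tau> * (q - p)) \<le> l * (z - q)" using z lm by (intro mult_left_mono) auto
    also have "\<dots> \<le> h z - h q" using h[OF pq(2) z(1)] z pos by auto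
    finally have "Q + l / m * \<tau> * (Q - P) \<le> h z" using sc unfolding pq(3,4) by linarith
    then show "\<exists>z\<in>h ` A. Q + l / m * \<tau> * (Q - P) \<le> z" using z by blast
  next
    fix P Q R S assume *: "line_gap (h ` A) P Q" "line_gap (h ` A) R S" "Q \<le> R"
    obtain p q where pq: "p \<in> A" "q \<in> A" "P = h p" "Q = h q" "line_gap A p q"
      using gap[OF *(1)] by blast
    obtain c d where cd: "c \<in> A" "d \<in> A" "R = h c" "S = h d" "line_gap A c d"
      using gap[OF *(2)] by blast
    have lt: "p \<le> q" "c \<le> d" "q \<le> c"
      using pq cd * mono[of c q] by (auto simp: line_gap_def not_less)
    have k: "0 \<le> l / m * \<tau>" using A lm by simp
    have "l / m * \<tau> * min (Q - P) (S - R) \<le> l * (\<tau> * (q - p))"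
      using mult_left_mono[OF min.cobounded1 k, of "Q - P" "S - R"] scale[OF pq(1,2) lt(1)]
      unfolding pq(3,4) by linarith
    moreover have "l / m * \<tau> * min (Q - P) (S - R) \<le> l * (\<tau> * (d - c))"
      using mult_left_mono[OF min.cobounded2 k, of "Q - P" "S - R"] scale[OF cd(1,2) lt(2)]
      unfolding cd(3,4) by linarith
    ultimately have "l / m * \<tau> * min (Q - P) (S - R) \<le> l * (\<tau> * min (q - p) (d - c))"
      by (simp add: min_def)
    also have "\<dots> \<le> l * (c - q)"
      using line_thickD(3)[OF A(1) pq(5) cd(5) lt(3)] lm by (intro mult_left_mono) auto
    also have "\<dots> \<le> R - Q" using h[OF pq(2) cd(1) lt(3)] pq cd by simp
    finally show "l / m * \<tau> * min (Q - P) (S - R) \<le> R - Q" .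
  qed
qed

text \<open>
  Unless an interval of \<open>A\<close> starts at \<open>b\<close>, take the longest gap \<open>{p<..<q}\<close> that starts within \<open>\<epsilon>\<close> to the
  right of \<open>b\<close> and cut \<open>A\<close> down to \<open>{b..p}\<close>. The gaps inside this piece are then no longer than the
  two gaps that bound it, so separation from these two gaps makes the hull of the piece long enough on both
  sides.
\<close>

lemma thick_piece_near_gap:
  assumes A: "compact A" "line_thick \<tau> A" "0 < \<tau>" and ob: "line_gap A a b" and "0 < \<eta>"
  shows "\<exists>S \<subseteq> A \<inter> {b..b + \<eta>}. compact S \<and> line_thick \<tau> S \<and> (\<exists>x\<in>S. \<exists>y\<in>S. x < y)"
proof -
  have "a < b" "b \<in> A" using ob by (auto simp: line_gap_def)
  \<comment> \<open>Gaps that start within \<open>\<epsilon>\<close> of \<open>b\<close> must be shorter than \<open>{a<..<b}\<close>, as a gap at least that long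
      keeps distance \<open>\<tau> * (b - a)\<close>.\<close>
  define \<epsilon> where "\<epsilon> = min \<eta> (\<tau> * (b - a) / 2)"
  have \<epsilon>: "0 < \<epsilon>" "\<epsilon> \<le> \<eta>" "\<epsilon> < \<tau> * (b - a)"
    using assms(3,5) \<open>a < b\<close> by (auto simp: \<epsilon>_def min_less_iff_disj)
  have near: "b < p \<and> \<tau> * (q - p) \<le> p - b \<and> q - p < b - a"
    if g: "line_gap A p q" "b \<le> p" "p \<le> b + \<epsilon>" for p q
  proof -
    have "\<tau> * min (b - a) (q - p) \<le> p - b"
      using line_thickD(3)[OF A(2) ob g(1,2)] .
    moreover from this have "\<tau> * min (b - a) (q - p) < \<tau> * (b - a)" using g \<epsilon> by linarith
    then have "q - p < b - a" using A(3) by (auto simp: min_def split: if_splits)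
    moreover have "0 < \<tau> * (q - p)" using g A(3) by (simp add: line_gap_def)
    ultimately show ?thesis by (simp add: min_def split: if_splits)
  qed
  show ?thesis
  proof (cases "{b..b + \<epsilon>} \<subseteq> A")
    case True
    have "\<not> line_gap {b..b + \<epsilon>} p q" for p q
    proof
      assume g: "line_gap {b..b + \<epsilon>} p q"
      then have "(p + q) / 2 \<in> {b..b + \<epsilon>}" by (auto simp: line_gap_def field_simps)
      then have "(p + q) / 2 \<le> p \<or> q \<le> (p + q) / 2" using g unfolding line_gap_def by blast
      then show False using g by (auto simp: line_gap_def field_simps)
    qed
    then have "line_thick \<tau> {b..b + \<epsilon>}" by (simp add: line_thick_def)
    moreover have "\<exists>x\<in>{b..b + \<epsilon>}. \<exists>y\<in>{b..b + \<epsilon>}. x < y"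
      using \<epsilon> by (intro bexI[of _ b] bexI[of _ "b + \<epsilon>"]) auto
    ultimately show ?thesis using True \<epsilon>(2)
      by (intro exI[of _ "{b..b + \<epsilon>}"]) auto
  next
    case False
    then obtain w where w: "b \<le> w" "w \<le> b + \<epsilon>" "w \<notin> A"
      by (meson atLeastAtMost_iff subsetI)
    obtain z where "z \<in> A" "b + \<tau> * (b - a) \<le> z" using line_thickD(2)[OF A(2) ob] by blast
    then obtain p0 q0 where g0: "line_gap A p0 q0" "b \<le> p0" "p0 < w"
      using line_gap_around[OF A(1) \<open>b \<in> A\<close>, of z w] w \<epsilon> by auto
    \<comment> \<open>Degenerate pairs are admitted to make \<open>K\<close> closed; \<open>(p0, q0)\<close> keeps the maximum positive.\<close>
    define K where "K = (A \<times> A) \<inter> {w. (\<forall>z\<in>A. z \<le> fst w \<or> snd w \<le> z) \<and> b \<le> fst w \<and> fst w \<le> b + \<epsilon>}"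
    have "closed {w :: real \<times> real. (\<forall>z\<in>A. z \<le> fst w \<or> snd w \<le> z) \<and> b \<le> fst w \<and> fst w \<le> b + \<epsilon>}"
      unfolding Ball_def
      by (intro closed_Collect_conj closed_Collect_disj closed_Collect_all closed_Collect_imp
        closed_Collect_le continuous_intros open_Collect_const)
    then have "compact K" using A(1) unfolding K_def by (intro compact_Int_closed compact_Times)
    moreover have g0K: "(p0, q0) \<in> K" using g0 w by (auto simp: K_def line_gap_def)
    moreover have "continuous_on K (\<lambda>w. snd w - fst w)" by (intro continuous_intros)
    ultimately obtain u where u: "u \<in> K" "\<And>v. v \<in> K \<Longrightarrow> snd v - fst v \<le> snd u - fst u"
      using continuous_attains_sup[of K "\<lambda>w. snd w - fst w"] by blast
    obtain p q where pq: "u = (p, q)" by fastforce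
    have "q0 - p0 \<le> q - p" using u(2)[OF g0K] pq by simp
    then have g: "line_gap A p q" "b \<le> p" "p \<le> b + \<epsilon>"
      using u(1) pq g0(1) by (auto simp: K_def line_gap_def)
    have "b < p" using near[OF g] by blast
    let ?S = "A \<inter> {b..p}"
    have "p \<in> ?S" "b \<in> ?S" using g \<open>b \<in> A\<close> by (auto simp: line_gap_def)
    have sub: "line_gap A c d \<and> b \<le> c \<and> d \<le> p \<and> d - c \<le> q - p \<and> d - c < b - a"
      if cd: "line_gap ?S c d" for c d
    proof -
      have *: "c \<in> A" "d \<in> A" "b \<le> c" "d \<le> p" "c < d" using cd by (auto simp: line_gap_def)
      have "z \<le> c \<or> d \<le> z" if "z \<in> A" for z
        using cd * that by (cases "z \<in> ?S") (auto simp: line_gap_def)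
      then have gap: "line_gap A c d" using * by (simp add: line_gap_def)
      then have "(c, d) \<in> K" using * g by (auto simp: K_def line_gap_def)
      then show ?thesis using u(2)[of "(c, d)"] pq gap * near[OF gap] g by auto
    qed
    have "line_thick \<tau> ?S"
    proof (rule line_thickI)
      fix c d assume cd: "line_gap ?S c d"
      note s = sub[OF cd]
      have "\<tau> * min (b - a) (d - c) \<le> c - b" using line_thickD(3)[OF A(2) ob] s by blast
      then have "b \<le> c - \<tau> * (d - c)" using s by (simp add: min_def)
      then show "\<exists>z\<in>?S. z \<le> c - \<tau> * (d - c)" using \<open>b \<in> ?S\<close> by blast
      have "\<tau> * min (d - c) (q - p) \<le> p - d" using line_thickD(3)[OF A(2) _ g(1)] s by blast
      then have "d + \<tau> * (d - c) \<le> p" using s by (simp add: min_def)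
      then show "\<exists>z\<in>?S. d + \<tau> * (d - c) \<le> z" using \<open>p \<in> ?S\<close> by blast
    next
      fix c d c' d' assume "line_gap ?S c d" "line_gap ?S c' d'" "d \<le> c'"
      then show "\<tau> * min (d - c) (d' - c') \<le> c' - d" using line_thickD(3)[OF A(2)] sub by blast
    qed
    moreover have "compact ?S" using A(1) by (intro compact_Int_closed) auto
    moreover have "?S \<subseteq> A \<inter> {b..b + \<eta>}" using g(3) \<epsilon>(2) by auto
    ultimately show ?thesis using \<open>p \<in> ?S\<close> \<open>b \<in> ?S\<close> \<open>b < p\<close> by blast
  qed
qed

text \<open>
  On \<open>{b..b / \<kappa>}\<close> the difference quotients of the square map lie between \<open>2 * b\<close> and \<open>2 * b / \<kappa>\<close>, two
  bounds of ratio \<open>\<kappa>\<close>.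
\<close>

lemma thick_squares_pos:
  assumes A: "compact A" "line_thick \<tau> A" "0 < \<tau>" and gap: "line_gap A a b" "0 < b"
    and \<kappa>: "0 < \<kappa>" "\<kappa> < 1"
  shows "\<exists>S \<subseteq> (\<lambda>u. u\<^sup>2) ` A. compact S \<and> line_thick (\<kappa> * \<tau>) S \<and> (\<exists>x\<in>S. \<exists>y\<in>S. x < y)"
proof -
  define m where "m = b / \<kappa>"
  have m: "b < m" "0 < m" using gap \<kappa> by (auto simp: m_def field_simps)
  obtain T where T: "T \<subseteq> A" "T \<subseteq> {b..m}" "compact T" "line_thick \<tau> T" "\<exists>x\<in>T. \<exists>y\<in>T. x < y"
    using thick_piece_near_gap[OF A gap(1), of "m - b"] m by auto
  have sq: "2 * b * (y - x) \<le> y\<^sup>2 - x\<^sup>2 \<and> y\<^sup>2 - x\<^sup>2 \<le> 2 * m * (y - x)"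
    if "x \<in> T" "y \<in> T" "x \<le> y" for x y
  proof -
    have "y\<^sup>2 - x\<^sup>2 = (y + x) * (y - x)" by (simp add: power2_eq_square algebra_simps)
    moreover have "2 * b \<le> y + x" "y + x \<le> 2 * m" using that T(2) by force+
    ultimately show ?thesis using that by (auto intro: mult_right_mono)
  qed
  have "line_thick (2 * b / (2 * m) * \<tau>) ((\<lambda>u. u\<^sup>2) ` T)"
    by (rule line_thick_image[OF T(4) A(3)]) (use gap m sq in auto)
  moreover have "2 * b / (2 * m) = \<kappa>" using gap \<kappa> by (simp add: m_def)
  moreover have "compact ((\<lambda>u. u\<^sup>2) ` T)" using T(3) by (intro compact_continuous_image continuous_intros)
  moreover have "\<exists>x\<in>(\<lambda>u. u\<^sup>2) ` T. \<exists>y\<in>(\<lambda>u. u\<^sup>2) ` T. x < y"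
  proof -
    obtain x y where xy: "x \<in> T" "y \<in> T" "x < y" using T(5) by blast
    then have "0 \<le> x" using T(2) gap by force
    then have "x\<^sup>2 < y\<^sup>2" using xy by (intro power_strict_mono) auto
    then show ?thesis using xy by blast
  qed
  ultimately show ?thesis using T(1) by (metis image_mono)
qed

text \<open>As \<open>0\<close> lies in \<open>A\<close>, no gap contains it, so either the gap or its mirror image ends on the positive side.\<close>

lemma thick_squares:
  assumes A: "compact A" "line_thick \<tau> A" "0 < \<tau>" and gap: "line_gap A a b" and "0 \<in> A"
    and \<kappa>: "0 < \<kappa>" "\<kappa> < 1"
  shows "\<exists>S \<subseteq> (\<lambda>u. u\<^sup>2) ` A. compact S \<and> line_thick (\<kappa> * \<tau>) S \<and> (\<exists>x\<in>S. \<exists>y\<in>S. x < y)"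
proof (cases "0 < b")
  case True
  then show ?thesis using thick_squares_pos[OF A gap _ \<kappa>] by blast
next
  case False
  let ?R = "(\<lambda>u. 0 - u) ` A"
  have "compact ?R" using A(1) by (intro compact_continuous_image continuous_intros)
  moreover have "line_gap ?R (- b) (- a)" "0 < - a"
    using gap False by (auto simp: line_gap_reflect) (auto simp: line_gap_def)
  moreover have "(\<lambda>u. u\<^sup>2) ` ?R = (\<lambda>u. u\<^sup>2) ` A" by (simp add: image_image)
  ultimately show ?thesis
    using thick_squares_pos[OF _ line_thick_reflect[OF A(2)] A(3) _ _ \<kappa>, of 0 "- b" "- a"] by simp
qed

text \<open>Both factors lose \<open>\<kappa>\<close>, so \<open>\<kappa>\<close> is chosen with \<open>\<kappa>\<^sup>2 * (a * b) > 1\<close>.\<close>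

lemma thick_sum_of_squares:
  assumes A: "compact A" "line_thick a A" "0 < a" "line_gap A p q" "0 \<in> A"
    and B: "compact B" "line_thick b B" "0 < b" "line_gap B r s" "0 \<in> B"
    and ab: "1 < a * b"
  shows "\<exists>l h. l < h \<and> {l<..<h} \<subseteq> {u\<^sup>2 + v\<^sup>2 |u v. u \<in> A \<and> v \<in> B}"
proof -
  have "sqrt (1 / (a * b)) < 1" using ab by simp
  then obtain \<kappa> where \<kappa>: "sqrt (1 / (a * b)) < \<kappa>" "\<kappa> < 1" using dense by blast
  have pos: "0 < \<kappa>" using \<kappa>(1) A(3) B(3) by (smt (verit) mult_pos_pos divide_nonneg_pos real_sqrt_ge_zero)
  have "1 / (a * b) < \<kappa>\<^sup>2" using \<kappa>(1) pos real_less_rsqrt sqrt_le_D by (meson not_less real_le_rsqrt less_imp_le)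
  then have ab': "1 < (\<kappa> * a) * (\<kappa> * b)"
    using A(3) B(3) by (simp add: field_simps power2_eq_square)
  obtain S \<alpha> \<beta> where S: "S \<subseteq> (\<lambda>u. u\<^sup>2) ` A" "compact S" "line_thick (\<kappa> * a) S" "\<alpha> \<in> S" "\<beta> \<in> S" "\<alpha> < \<beta>"
    using thick_squares[OF A pos \<kappa>(2)] by blast
  obtain T \<gamma> \<delta> where T: "T \<subseteq> (\<lambda>u. u\<^sup>2) ` B" "compact T" "line_thick (\<kappa> * b) T" "\<gamma> \<in> T" "\<delta> \<in> T" "\<gamma> < \<delta>"
    using thick_squares[OF B pos \<kappa>(2)] by blast
  have "{max (\<alpha> + \<delta>) (\<beta> + \<gamma>)<..<\<beta> + \<delta>} \<subseteq> {u + v |u v. u \<in> S \<and> v \<in> T}"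
    by (rule thick_sums_contain_interval[OF S(2,3) _ T(2,3) _ ab' S(4-6) T(4-6)])
      (use A(3) B(3) pos in auto)
  also have "\<dots> \<subseteq> {u\<^sup>2 + v\<^sup>2 |u v. u \<in> A \<and> v \<in> B}"
    using S(1) T(1) by fast
  finally show ?thesis using S(6) T(6) by (intro exI conjI) auto
qed

section \<open>Compact sets in one-dimensional spaces\<close>

text \<open>
  In dimension 1 the map \<open>r \<mapsto> x + r *\<^sub>R e\<close> is an isometry of the line onto the whole space, which carries
  the gaps of the section to the bounded gaps of \<open>C\<close>. The endpoints of gaps are approached from inside,
  with an error \<open>\<epsilon>\<close> for each of two endpoints, because \<open>gaps_separated\<close> speaks of points in the open gaps.
\<close>

lemma line_section_thick:
  fixes C :: "'a::euclidean_space set" and x e :: 'a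
  assumes dim: "DIM('a) = 1" and e: "e \<in> Basis" and C: "compact C"
    and ne: "bounded_gaps C \<noteq> {}" and th: "0 < \<tau>" "ereal \<tau> \<le> thickness C"
  defines "A \<equiv> {r. x + r *\<^sub>R e \<in> C}"
  shows "compact A" "line_thick \<tau> A" "\<exists>p q. line_gap A p q"
proof -
  define J where "J r = x + r *\<^sub>R e" for r
  define coord where "coord y = (y - x) \<bullet> e" for y
  have Basis: "b = e" if "b \<in> Basis" for b :: 'a
    using dim e that by (metis card_1_singletonE singletonD)
  have "z = (z \<bullet> e) *\<^sub>R e" for z :: 'a
  proof (rule euclidean_eqI)
    fix b :: 'a assume "b \<in> Basis"
    then have "b = e" by (rule Basis)
    then show "z \<bullet> b = ((z \<bullet> e) *\<^sub>R e) \<bullet> b" using e by simp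
  qed
  then have "(y - x) = ((y - x) \<bullet> e) *\<^sub>R e" for y by blast
  then have J_coord: "J (coord y) = y" for y
    unfolding J_def coord_def by (metis add_diff_cancel_left' diff_add_cancel add.commute)
  have "norm e = 1" using e by simp
  have coord_J: "coord (J r) = r" for r using e by (simp add: J_def coord_def)
  have dist_J: "dist (J r) (J s) = \<bar>r - s\<bar>" for r s
  proof -
    have "J r - J s = (r - s) *\<^sub>R e" by (simp add: J_def algebra_simps)
    then show ?thesis using \<open>norm e = 1\<close> by (simp add: dist_norm)
  qed
  have cont_J: "continuous_on S J" for S unfolding J_def by (intro continuous_intros)
  have cont_coord: "continuous_on S coord" for S unfolding coord_def by (intro continuous_intros)
  have mem: "r \<in> A \<longleftrightarrow> J r \<in> C" for r by (simp add: A_def J_def)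
  have "A = coord ` C"
  proof
    show "A \<subseteq> coord ` C" using mem coord_J by (metis image_eqI subsetI)
    show "coord ` C \<subseteq> A" using mem J_coord by auto
  qed
  then show compA: "compact A"
    using C cont_coord by (simp add: compact_continuous_image)
  have in_gap: "J ` S \<subseteq> V"
    if "convex S" "S \<inter> A = {}" "r \<in> S" "J r \<in> V" "V \<in> complement_path_components C" for S V r
  proof (rule path_connected_subset_gap[of _ C "J r"])
    show "path_connected (J ` S)"
      using cont_J that(1) by (intro path_connected_continuous_image convex_imp_path_connected)
    show "J ` S \<subseteq> - C" using that(2) mem by blast
  qed (use that in auto)
  have comp: "path_component_set (- C) (J r) \<in> complement_path_components C"
    "J r \<in> path_component_set (- C) (J r)" if "r \<notin> A" for r
    using that mem by (auto simp: complement_path_components_def path_component_refl_eq)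
  have unbounded_ray: "\<not> bounded V" if V: "J ` {z<..} \<subseteq> V \<or> J ` {..<z} \<subseteq> V" for z V
  proof
    assume "bounded V"
    then obtain R where R: "\<And>y. y \<in> V \<Longrightarrow> dist (J z) y \<le> R" using bounded_any_center by blast
    have "J (z + (\<bar>R\<bar> + 1)) \<in> J ` {z<..}" "J (z - (\<bar>R\<bar> + 1)) \<in> J ` {..<z}" by auto
    then have "J (z + (\<bar>R\<bar> + 1)) \<in> V \<or> J (z - (\<bar>R\<bar> + 1)) \<in> V" using V by blast
    then show False using R[of "J (z + (\<bar>R\<bar> + 1))"] R[of "J (z - (\<bar>R\<bar> + 1))"] by (auto simp: dist_J)
  qed
  have gap_comp: "J ` {p<..<q} \<in> bounded_gaps C" if g: "line_gap A p q" for p q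
  proof -
    define V where "V = path_component_set (- C) (J ((p + q) / 2))"
    have m: "(p + q) / 2 \<in> {p<..<q}" "{p<..<q} \<inter> A = {}" using g by (auto simp: line_gap_def)
    then have V: "V \<in> complement_path_components C" "J ((p + q) / 2) \<in> V"
      using comp unfolding V_def by blast+
    have "J ` {p<..<q} \<subseteq> V" using in_gap[OF _ m(2,1) V(2,1)] by simp
    moreover have "V \<subseteq> J ` {p<..<q}"
    proof
      fix y assume "y \<in> V"
      \<comment> \<open>The coordinates of \<open>V\<close> form an interval that meets \<open>{p<..<q}\<close> and avoids \<open>p\<close> and \<open>q\<close>.\<close>
      have "connected (coord ` V)"
        unfolding V_def by (intro connected_continuous_image cont_coord path_connected_imp_connected) simp
      then have conn: "is_interval (coord ` V)" by (simp add: is_interval_connected_1)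
      have ends: "coord y \<in> coord ` V" "(p + q) / 2 \<in> coord ` V"
        using \<open>y \<in> V\<close> V(2) coord_J by (auto intro: image_eqI[OF sym])
      have "V \<subseteq> - C" unfolding V_def using path_component_subset by blast
      then have disj: "coord ` V \<inter> A = {}"
        using mem J_coord by auto
      have "p \<notin> coord ` V" "q \<notin> coord ` V" using disj g by (auto simp: line_gap_def)
      then have "p < coord y" "coord y < q"
        using conn ends m(1) unfolding is_interval_1
        by (meson greaterThanLessThan_iff less_imp_le not_le)+
      then show "y \<in> J ` {p<..<q}" using J_coord by (metis greaterThanLessThan_iff image_eqI)
    qed
    moreover have "bounded (J ` {p<..<q})"
      by (rule bounded_subset[of "J ` {p..q}"])
        (auto intro!: compact_imp_bounded compact_continuous_image cont_J)
    ultimately show ?thesis using V(1) by (auto simp: bounded_gaps_def)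
  qed
  have diam: "q - p \<le> diameter (J ` {p<..<q})" if g: "line_gap A p q" for p q
  proof -
    let ?U = "J ` {p<..<q}"
    have bU: "bounded ?U" using gap_comp[OF g] by (simp add: bounded_gaps_def)
    have pq: "p < q" using g by (simp add: line_gap_def)
    have "d \<le> diameter ?U" if d: "0 < d" "d < q - p" for d
    proof -
      let ?m = "(p + q) / 2"
      have "J (?m - d/2) \<in> ?U" "J (?m + d/2) \<in> ?U" using d by (auto simp: field_simps)
      then have "dist (J (?m - d/2)) (J (?m + d/2)) \<le> diameter ?U"
        using bU diameter_bounded_bound by blast
      then show ?thesis using d by (simp add: dist_J)
    qed
    then show ?thesis using pq dense_le_bounded[of 0 "q - p" "diameter ?U"] by simp
  qed
  have sep: "\<tau> * (q - p) \<le> \<bar>u - t\<bar> \<or> bounded V \<and> \<tau> * diameter V \<le> \<bar>u - t\<bar>"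
    if g: "line_gap A p q" "p < u" "u < q" and t: "J t \<in> V" "V \<in> complement_path_components C"
      "t \<notin> {p<..<q}" for p q u t V
  proof -
    have "V \<noteq> J ` {p<..<q}" using t coord_J by (metis imageE)
    moreover have "J u \<in> J ` {p<..<q}" using g by auto
    ultimately have "\<tau> * diameter (J ` {p<..<q}) \<le> \<bar>u - t\<bar> \<or> bounded V \<and> \<tau> * diameter V \<le> \<bar>u - t\<bar>"
      using gaps_separated[OF th gap_comp[OF g(1)] t(2) _ _ t(1), of "J u"] unfolding dist_J by blast
    moreover have "\<tau> * (q - p) \<le> \<tau> * diameter (J ` {p<..<q})"
      using diam[OF g(1)] th by simp
    ultimately show ?thesis by linarith
  qed
  have small: "D \<le> M" if "0 < L" and le: "\<And>\<epsilon>. 0 < \<epsilon> \<Longrightarrow> \<epsilon> < L \<Longrightarrow> D \<le> M + 2 * \<epsilon>" for D M L :: real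
  proof (rule ccontr)
    assume "\<not> D \<le> M"
    define \<epsilon> where "\<epsilon> = min (L / 2) ((D - M) / 4)"
    have "0 < \<epsilon>" "\<epsilon> < L"
      using \<open>\<not> D \<le> M\<close> \<open>0 < L\<close> by (auto simp: \<epsilon>_def min_less_iff_disj)
    moreover have "\<epsilon> \<le> (D - M) / 4" unfolding \<epsilon>_def by (rule min.cobounded2)
    ultimately show False using le[of \<epsilon>] \<open>\<not> D \<le> M\<close> by simp
  qed
  show "line_thick \<tau> A"
  proof (rule line_thickI)
    fix p q assume g: "line_gap A p q"
    then have "A \<noteq> {}" "p < q" by (auto simp: line_gap_def)
    then obtain l r where lr: "l \<in> A" "r \<in> A" "\<And>z. z \<in> A \<Longrightarrow> l \<le> z \<and> z \<le> r"
      using compact_attains_inf[OF compA] compact_attains_sup[OF compA] by metis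
    have lp: "l \<le> p" "q \<le> r" using lr g by (auto simp: line_gap_def)
    \<comment> \<open>Beyond the extreme points of \<open>A\<close> lie unbounded components, so the distance of the gap to the
        unbounded gap bounds the room between the gap and the ends of the hull.\<close>
    have "\<tau> * (q - p) \<le> (p - l) + 2 * \<epsilon>" if \<epsilon>: "0 < \<epsilon>" "\<epsilon> < q - p" for \<epsilon>
    proof -
      define V where "V = path_component_set (- C) (J (l - \<epsilon>))"
      have out: "{..<l} \<inter> A = {}" using lr(3) by force
      have nA: "l - \<epsilon> \<notin> A" using lr(3)[of "l - \<epsilon>"] \<epsilon> by auto
      have "J ` {..<l} \<subseteq> V"
        by (rule in_gap[OF _ out, of "l - \<epsilon>"]) (use comp[OF nA] \<epsilon> V_def in auto)
      then have "\<not> bounded V" using unbounded_ray by blast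
      then have "\<tau> * (q - p) \<le> \<bar>(p + \<epsilon>) - (l - \<epsilon>)\<bar>"
        using sep[OF g, of "p + \<epsilon>" "l - \<epsilon>" V] comp[OF nA] \<epsilon> lp V_def by auto
      then show ?thesis using \<epsilon> lp by simp
    qed
    then have "\<tau> * (q - p) \<le> p - l" using small \<open>p < q\<close> by (meson diff_gt_0_iff_gt)
    then show "\<exists>z\<in>A. z \<le> p - \<tau> * (q - p)" using lr(1) by (intro bexI[of _ l]) auto
    have "\<tau> * (q - p) \<le> (r - q) + 2 * \<epsilon>" if \<epsilon>: "0 < \<epsilon>" "\<epsilon> < q - p" for \<epsilon>
    proof -
      define V where "V = path_component_set (- C) (J (r + \<epsilon>))"
      have out: "{r<..} \<inter> A = {}" using lr(3) by force
      have nA: "r + \<epsilon> \<notin> A" using lr(3)[of "r + \<epsilon>"] \<epsilon> by auto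
      have "J ` {r<..} \<subseteq> V"
        by (rule in_gap[OF _ out, of "r + \<epsilon>"]) (use comp[OF nA] \<epsilon> V_def in auto)
      then have "\<not> bounded V" using unbounded_ray by blast
      then have "\<tau> * (q - p) \<le> \<bar>(q - \<epsilon>) - (r + \<epsilon>)\<bar>"
        using sep[OF g, of "q - \<epsilon>" "r + \<epsilon>" V] comp[OF nA] \<epsilon> lp V_def by auto
      then show ?thesis using \<epsilon> lp by simp
    qed
    then have "\<tau> * (q - p) \<le> r - q" using small \<open>p < q\<close> by (meson diff_gt_0_iff_gt)
    then show "\<exists>z\<in>A. q + \<tau> * (q - p) \<le> z" using lr(2) by (intro bexI[of _ r]) auto
  next
    fix p q c d assume g: "line_gap A p q" "line_gap A c d" "q \<le> c"
    then have lt: "p < q" "c < d" by (auto simp: line_gap_def)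
    have "\<tau> * min (q - p) (d - c) \<le> (c - q) + 2 * \<epsilon>" if \<epsilon>: "0 < \<epsilon>" "\<epsilon> < min (q - p) (d - c)" for \<epsilon>
    proof -
      have V: "J (c + \<epsilon>) \<in> J ` {c<..<d}" "J ` {c<..<d} \<in> complement_path_components C"
        using gap_comp[OF g(2)] \<epsilon> by (auto simp: bounded_gaps_def)
      have "\<tau> * (q - p) \<le> \<bar>(q - \<epsilon>) - (c + \<epsilon>)\<bar> \<or> \<tau> * diameter (J ` {c<..<d}) \<le> \<bar>(q - \<epsilon>) - (c + \<epsilon>)\<bar>"
        using sep[OF g(1) _ _ V, of "q - \<epsilon>"] \<epsilon> g(3) by auto
      moreover have "\<tau> * (d - c) \<le> \<tau> * diameter (J ` {c<..<d})" using diam[OF g(2)] th by simp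
      moreover have "\<tau> * min (q - p) (d - c) \<le> \<tau> * (q - p)" "\<tau> * min (q - p) (d - c) \<le> \<tau> * (d - c)"
        using th by (auto intro: mult_left_mono)
      moreover have "\<bar>(q - \<epsilon>) - (c + \<epsilon>)\<bar> = (c - q) + 2 * \<epsilon>" using g(3) \<epsilon> by simp
      ultimately show ?thesis by linarith
    qed
    moreover have "0 < min (q - p) (d - c)" using lt by simp
    ultimately show "\<tau> * min (q - p) (d - c) \<le> c - q" using small by meson
  qed
  obtain G where G: "G \<in> bounded_gaps C" using ne by blast
  then have Gc: "G \<in> complement_path_components C" and Gb: "bounded G"
    by (auto simp: bounded_gaps_def)
  then obtain y where y: "y \<in> G" "y \<notin> C"
    by (auto simp: complement_path_components_def intro: path_component_refl)
  define r where "r = coord y"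
  have Jr: "J r \<in> G" "r \<notin> A" using y mem J_coord by (auto simp: r_def)
  have "\<exists>z\<in>A. z \<le> r"
  proof (rule ccontr)
    assume "\<not> ?thesis"
    then have "J ` {..<r} \<subseteq> G"
      using in_gap[of "{..r}" r G] Jr Gc by force
    then show False using unbounded_ray Gb by blast
  qed
  moreover have "\<exists>z\<in>A. r \<le> z"
  proof (rule ccontr)
    assume "\<not> ?thesis"
    then have "J ` {r<..} \<subseteq> G"
      using in_gap[of "{r..}" r G] Jr Gc by force
    then show False using unbounded_ray Gb by blast
  qed
  ultimately show "\<exists>p q. line_gap A p q"
    using line_gap_around[OF compA _ _ _ _ Jr(2)] by blast
qed

lemma pinned_distance_set_line_interior:
  fixes C1 C2 :: "'a::euclidean_space set" and x :: "'a \<times> 'a"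
  assumes dim: "DIM('a) = 1" and C: "compact C1" "compact C2"
    and ne: "bounded_gaps C1 \<noteq> {}" "bounded_gaps C2 \<noteq> {}"
    and a: "0 < a" "ereal a \<le> thickness C1" and b: "0 < b" "ereal b \<le> thickness C2"
    and ab: "1 < a * b" and x: "x \<in> C1 \<times> C2"
  shows "interior (pinned_distance_set x (C1 \<times> C2)) \<noteq> {}"
proof -
  obtain e :: 'a where e: "e \<in> Basis" using nonempty_Basis by blast
  define A where "A = {r. fst x + r *\<^sub>R e \<in> C1}"
  define B where "B = {r. snd x + r *\<^sub>R e \<in> C2}"
  have "0 \<in> A" "0 \<in> B" using x by (auto simp: A_def B_def)
  obtain p q where A: "compact A" "line_thick a A" "line_gap A p q"
    using line_section_thick[OF dim e C(1) ne(1) a, of "fst x"] unfolding A_def by blast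
  obtain r s where B: "compact B" "line_thick b B" "line_gap B r s"
    using line_section_thick[OF dim e C(2) ne(2) b, of "snd x"] unfolding B_def by blast
  obtain l h where lh: "l < h" "{l<..<h} \<subseteq> {u\<^sup>2 + v\<^sup>2 |u v. u \<in> A \<and> v \<in> B}"
    using thick_sum_of_squares[OF A(1,2) a(1) A(3) \<open>0 \<in> A\<close> B(1,2) b(1) B(3) \<open>0 \<in> B\<close> ab] by blast
  have pinned: "sqrt (u\<^sup>2 + v\<^sup>2) \<in> pinned_distance_set x (C1 \<times> C2)" if "u \<in> A" "v \<in> B" for u v
  proof -
    let ?y = "(fst x + u *\<^sub>R e, snd x + v *\<^sub>R e)"
    have "?y \<in> C1 \<times> C2" using that by (simp add: A_def B_def)
    moreover have "norm (x - ?y) = sqrt (u\<^sup>2 + v\<^sup>2)"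
      using e by (cases x) (simp add: norm_prod_def)
    ultimately show ?thesis unfolding pinned_distance_set_def by (metis imageI)
  qed
  have "0 < h"
  proof -
    have "(l + h) / 2 \<in> {l<..<h}" using lh(1) by simp
    then obtain u v where "(l + h) / 2 = u\<^sup>2 + v\<^sup>2" using lh(2) by blast
    then have "0 \<le> (l + h) / 2" by simp
    then show ?thesis using lh(1) by simp
  qed
  \<comment> \<open>The maximum keeps \<open>t\<close> nonnegative, so that \<open>t\<close> is recovered from \<open>t\<^sup>2\<close>.\<close>
  let ?I = "{sqrt (max l 0)<..<sqrt h}"
  have "?I \<subseteq> pinned_distance_set x (C1 \<times> C2)"
  proof
    fix t assume t: "t \<in> ?I"
    moreover have "0 \<le> sqrt (max l 0)" by simp
    ultimately have "0 < t" unfolding greaterThanLessThan_iff by linarith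
    have "max l 0 < t\<^sup>2" "t\<^sup>2 < h"
      using t \<open>0 < t\<close> real_sqrt_less_iff[of "max l 0" "t\<^sup>2"] real_sqrt_less_iff[of "t\<^sup>2" h] by auto
    then have "t\<^sup>2 \<in> {l<..<h}" by simp
    then obtain u v where uv: "t\<^sup>2 = u\<^sup>2 + v\<^sup>2" "u \<in> A" "v \<in> B" using lh(2) by blast
    have "t = sqrt (u\<^sup>2 + v\<^sup>2)" using uv(1) \<open>0 < t\<close> by (metis less_imp_le real_sqrt_unique)
    then show "t \<in> pinned_distance_set x (C1 \<times> C2)" using pinned uv by simp
  qed
  then have "?I \<subseteq> interior (pinned_distance_set x (C1 \<times> C2))" by (simp add: interior_maximal)
  moreover have "?I \<noteq> {}" using lh(1) \<open>0 < h\<close> by simp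
  ultimately show ?thesis by blast
qed

section \<open>Pinned distances to products\<close>

theorem corollary1p9:
  fixes C1 C2 :: "'a::euclidean_space set" and x :: "'a \<times> 'a"
  assumes "compact C1" and "compact C2"
    and "thickness C1 * thickness C2 > 1"
    and "x \<in> C1 \<times> C2"
  shows "interior (pinned_distance_set x (C1 \<times> C2)) \<noteq> {}"
proof -
  have x: "fst x \<in> C1" "snd x \<in> C2" using assms(4) by (simp_all add: mem_Times_iff)
  have fst_factor: ?thesis if "interior (pinned_distance_set (fst x) C1) \<noteq> {}"
    using interior_mono[OF pinned_distance_set_fst_subset[OF x(2), of C1]] that by blast
  have snd_factor: ?thesis if "interior (pinned_distance_set (snd x) C2) \<noteq> {}"
    using interior_mono[OF pinned_distance_set_snd_subset[OF x(1), of C2]] that by blast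
  have nz: "thickness C1 \<noteq> 0" "thickness C2 \<noteq> 0" using assms(3) by auto
  consider "interior C1 \<noteq> {}" | "interior C2 \<noteq> {}"
    | "bounded_gaps C1 \<noteq> {}" "bounded_gaps C2 \<noteq> {}"
    using bounded_gaps_nonempty_if_thickness_nonzero nz by blast
  then show ?thesis
  proof cases
    case 1
    then show ?thesis using fst_factor pinned_distance_set_interior by blast
  next
    case 2
    then show ?thesis using snd_factor pinned_distance_set_interior by blast
  next
    case 3
    obtain a b where a: "0 \<le> a" "thickness C1 = ereal a" and b: "0 \<le> b" "thickness C2 = ereal b"
      using thickness_real 3 by metis
    have ab: "1 < a * b" using assms(3) a b by (simp add: one_ereal_def)
    then have pos: "0 < a" "0 < b" using a(1) b(1) by (auto simp: less_le)
    show ?thesis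
    proof (cases "DIM('a) = 1")
      case True
      then show ?thesis
        using pinned_distance_set_line_interior[OF True assms(1,2) 3 pos(1) _ pos(2) _ ab assms(4)] a b by simp
    next
      case False
      then have "2 \<le> DIM('a)" using DIM_positive[where 'a='a] by linarith
      then show ?thesis
        using fst_factor pinned_distance_set_thick_interior[OF _ pos(1) _ 3(1)] a assms(1)
        by (simp add: compact_imp_closed)
    qed
  qed
qed

end
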